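(* Let $p\geq 5$ be a prime number and $n$ a positive integer. Then \[ \binom{np-1}{p-1}_{3}\equiv \begin{cases} 1+2np\,q_{p}(2) \pmod{p^2} & \text{if } p\equiv 1 \pmod 4,\\[2pt] -\tfrac{1}{2}np\,q_{p}(2) \pmod{p^2} & \text{if } p\equiv 3 \pmod 4, \end{cases} \] and \[ \binom{np-1}{\frac{p-1}{2}}_{3}\equiv \begin{cases} 1+np\left(\tfrac{13}{4}q_{p}(2)+\chi_{p}\right) \pmod{p^2} & \text{if } p\equiv 1 \pmod 8,\\[2pt] -1-np\left(\tfrac{13}{4}q_{p}(2)+\chi_{p}\right) \pmod{p^2} & \text{if } p\equiv 3 \pmod 8,\\[2pt] -np\left(\tfrac{1}{4}q_{p}(2)-\chi_{p}\right) \pmod{p^2} & \text{if } p\equiv 5 \pmod 8,\\[2pt] np\left(\tfrac{1}{4}q_{p}(2)-\chi_{p}\right) \pmod{p^2} & \text{if } p\equiv 7 \pmod 8. \end{cases} \]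
   Context: For a nonnegative integer $m$, the quadrinomial coefficients $\binom{m}{k}_{3}$ are defined by $(1+x+x^2+x^3)^{m}=\sum_{k=0}^{3m}\binom{m}{k}_{3}x^{k}$. For an integer $a$ not divisible by $p$, $q_p(a)=\frac{a^{p-1}-1}{p}$ is the Fermat quotient. The Pell sequence is $P_0=0$, $P_1=1$, $P_{m+1}=2P_m+P_{m-1}$, and the Pell quotient is $\chi_p=P_{p-(\frac{2}{p})}/p$, where $(\frac{2}{p})$ is the Legendre symbol. Congruences between rational numbers whose denominators are coprime to $p$ are understood in the ring of $p$-integral rationals. *)

theory Defs
  imports "HOL-Computational_Algebra.Computational_Algebra" "HOL-Number_Theory.Number_Theory"
begin

definition quadrinomial :: "nat \<Rightarrow> nat \<Rightarrow> int" where
  "quadrinomial m k = Polynomial.coeff ([:1, 1, 1, 1:] ^ m) k"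

definition fermat_quotient :: "nat \<Rightarrow> int \<Rightarrow> rat" where
  "fermat_quotient p a = (of_int a ^ (p - 1) - 1) / of_nat p"

fun pell :: "nat \<Rightarrow> nat" where
  "pell 0 = 0"
| "pell (Suc 0) = 1"
| "pell (Suc (Suc m)) = 2 * pell (Suc m) + pell m"

definition pell_quotient :: "nat \<Rightarrow> rat" where
  "pell_quotient p = of_nat (pell (nat (int p - Legendre 2 (int p)))) / of_nat p"

(* quotient_of returns numerator and positive denominator in lowest terms. *)
definition p_integral :: "nat \<Rightarrow> rat set" where
  "p_integral p = {r. coprime (snd (quotient_of r)) (int p)}"

(* Congruence modulo p^e in the ring of p-integral rationals, that is, modulo the ideal
   generated by p^e in that ring. *)
definition p_cong :: "nat \<Rightarrow> nat \<Rightarrow> rat \<Rightarrow> rat \<Rightarrow> bool" where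
  "p_cong p e x y \<longleftrightarrow>
     x \<in> p_integral p \<and> y \<in> p_integral p \<and>
     (\<exists>z \<in> p_integral p. x - y = of_nat (p ^ e) * z)"

end

theory Submission
  imports Defs
begin

text \<open>
  Write \<open>F = 1 + x + x\<^sup>2 + x\<^sup>3 = (1 - x\<^sup>4) / (1 - x)\<close>. Modulo \<open>p\<^sup>2\<close> and \<open>x\<^sup>p\<close> one has \<open>F\<^sup>n\<^sup>p = 1 + n p log F\<close>,
  which follows by comparing coefficients in \<open>(F\<^sup>n\<^sup>p)' = n p F\<^sup>n\<^sup>p\<^sup>-\<^sup>1 F'\<close>. Dividing by \<open>F\<close> expresses the
  quadrinomial coefficients through the sums of \<open>1 / j\<close> over a residue class of \<open>j\<close> modulo 4, with
  \<open>j < p\<close> or \<open>j < p / 2\<close>. These sums come from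
  \<open>(2 + \<zeta> + \<zeta>\<^sup>-\<^sup>1)\<^sup>p = \<Sum>\<^sub>j (2p choose j) \<zeta>\<^sup>j\<^sup>-\<^sup>p\<close> for a root of unity \<open>\<zeta>\<close> of order 1, 2, 4 or 8,
  because \<open>(2p choose j)\<close> is congruent to \<open>- 2 p (- 1)\<^sup>j / j\<close> modulo \<open>p\<^sup>2\<close>. Order 8 yields \<open>(2 + \<surd>2)\<^sup>p\<close>, whose
  rational part is \<open>2\<^sup>(\<^sup>p\<^sup>+\<^sup>1\<^sup>)\<^sup>/\<^sup>2 P\<^sub>p\<close>.
\<close>

section \<open>Inverses modulo a prime and central binomial sums\<close>

text \<open>Fermat: \<open>j\<^sup>p\<^sup>-\<^sup>2\<close> is an integer inverse of \<open>j\<close> modulo \<open>p\<close>. It is exactly multiplicative in \<open>j\<close>.\<close>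

definition recip :: "nat \<Rightarrow> nat \<Rightarrow> int" where
  "recip p j = int j ^ (p - 2)"

lemma recip_mult: "recip p (a * b) = recip p a * recip p b"
  by (simp add: recip_def power_mult_distrib)

lemma mult_recip_cong:
  assumes "prime p" "\<not> p dvd j"
  shows "[int j * recip p j = 1] (mod int p)"
proof -
  have "p \<ge> 2" using assms(1) prime_ge_2_nat by blast
  hence e: "p - 1 = Suc (p - 2)" by simp
  have "[j ^ (p - 1) = 1] (mod p)"
    using fermat_theorem assms by blast
  hence "[int (j ^ (p - 1)) = int 1] (mod int p)"
    by (simp only: cong_int_iff)
  thus ?thesis
    unfolding recip_def e by simp
qed

lemma cong_mult_recip_iff:
  assumes "prime p" "\<not> p dvd j"
  shows "[int j * x = y] (mod int p) \<longleftrightarrow> [x = y * recip p j] (mod int p)"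
proof -
  have "coprime (int j) (int p)"
    using prime_imp_coprime[OF assms] by (simp add: coprime_commute)
  hence "[x = y * recip p j] (mod int p) \<longleftrightarrow> [int j * x = int j * (y * recip p j)] (mod int p)"
    by (simp add: cong_mult_lcancel)
  also have "[int j * (y * recip p j) = y * 1] (mod int p)"
    using cong_scalar_left[OF mult_recip_cong[OF assms], of y] by (simp add: ac_simps)
  hence "[int j * x = int j * (y * recip p j)] (mod int p) \<longleftrightarrow> [int j * x = y] (mod int p)"
    by (auto intro: cong_trans cong_sym)
  finally show ?thesis by simp
qed

text \<open>The exponent \<open>p - 2\<close> is odd, so the sign of \<open>- j\<close>, to which
  \<open>p - j\<close> is congruent, passes through the power.\<close>

lemma recip_diff_cong:
  assumes "odd p" "p \<ge> 3" "j \<le> p"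
  shows "[recip p (p - j) = - recip p j] (mod int p)"
proof -
  have "[int (p - j) = - int j] (mod int p)"
    using assms(3) by (simp add: cong_iff_dvd_diff of_nat_diff)
  hence "[int (p - j) ^ (p - 2) = (- int j) ^ (p - 2)] (mod int p)"
    by (rule cong_pow)
  moreover have "odd (p - 2)" using assms by auto
  ultimately show ?thesis by (simp add: recip_def)
qed

section \<open>Binomial coefficients of row \<open>2 * p\<close> modulo the square of
  \<open>p\<close>\<close>

lemma dvd_choose_double_prime:
  assumes "prime p" "0 < j" "j < p"
  shows "p dvd (2 * p choose j)"
proof -
  obtain i where j: "j = Suc i" using assms(2) gr0_implies_Suc by blast
  have "j * (2 * p choose j) = 2 * p * ((2 * p - 1) choose i)"
    unfolding j by (rule binomial_absorption)
  hence "p dvd j * (2 * p choose j)" by simp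
  moreover have "\<not> p dvd j" using assms nat_dvd_not_less by blast
  ultimately show ?thesis using assms(1) prime_dvd_mult_iff by blast
qed

text \<open>By Pascal's rule two neighbours in row \<open>2 * p - 1\<close> add up to an entry of
  row \<open>2 * p\<close> divisible by \<open>p\<close>, so the sign alternates from the initial
  value 1.\<close>

lemma choose_double_prime_minus_1_cong:
  assumes "prime p" "j < p"
  shows "[int ((2 * p - 1) choose j) = (-1) ^ j] (mod int p)"
  using assms(2)
proof (induction j)
  case (Suc j)
  have e: "2 * p = Suc (2 * p - 1)" using Suc.prems by simp
  have "int (2 * p choose Suc j) = int ((2 * p - 1) choose j) + int ((2 * p - 1) choose Suc j)"
    by (subst e, subst binomial_Suc_Suc) simp
  moreover have "[int (2 * p choose Suc j) = 0] (mod int p)"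
    using dvd_choose_double_prime[OF assms(1) _ Suc.prems] by (simp add: cong_0_iff)
  ultimately have "[int ((2 * p - 1) choose j) + int ((2 * p - 1) choose Suc j) = 0] (mod int p)"
    by simp
  from cong_diff[OF this Suc.IH] Suc.prems show ?case by simp
qed simp

text \<open>Absorption exhibits an explicit factor \<open>p\<close>; once it is cancelled, the
  cofactor matters only modulo \<open>p\<close>, where row \<open>2 * p - 1\<close> is
  known.\<close>

lemma choose_double_prime_cong:
  assumes "prime p" "0 < j" "j < p"
  shows "[int (2 * p choose j) = - 2 * int p * ((-1) ^ j * recip p j)] (mod (int p)\<^sup>2)"
proof -
  obtain c where c: "2 * p choose j = p * c" using dvd_choose_double_prime[OF assms] by blast
  obtain i where j: "j = Suc i" using assms(2) gr0_implies_Suc by blast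
  have "\<not> p dvd j" using assms nat_dvd_not_less by blast
  have "j * (2 * p choose j) = 2 * p * ((2 * p - 1) choose i)"
    unfolding j by (rule binomial_absorption)
  hence "p * (j * c) = p * (2 * ((2 * p - 1) choose i))"
    unfolding c by (simp add: ac_simps)
  hence "j * c = 2 * ((2 * p - 1) choose i)"
    using assms(3) by (subst (asm) mult_left_cancel) auto
  hence "int j * int c = 2 * int ((2 * p - 1) choose i)"
    by (metis of_nat_mult of_nat_numeral)
  moreover have "[2 * int ((2 * p - 1) choose i) = 2 * (-1) ^ i] (mod int p)"
    by (intro cong_scalar_left choose_double_prime_minus_1_cong) (use assms j in auto)
  ultimately have "[int j * int c = 2 * (-1) ^ i] (mod int p)" by simp
  hence "[int c = 2 * (-1) ^ i * recip p j] (mod int p)"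
    by (simp add: cong_mult_recip_iff[OF assms(1) \<open>\<not> p dvd j\<close>])
  hence "[int p * int c = int p * (2 * (-1) ^ i * recip p j)] (mod (int p * int p))"
    by (simp add: cong_iff_dvd_diff flip: right_diff_distrib)
  thus ?thesis unfolding c by (simp add: j power2_eq_square ac_simps)
qed

text \<open>The central coefficient is the sum of the squares of row \<open>p\<close>. The two ends
  give 2, and every inner square is divisible by \<open>p\<^sup>2\<close>.\<close>

lemma central_choose_prime_cong:
  assumes "prime p"
  shows "[int (2 * p choose p) = 2] (mod (int p)\<^sup>2)"
proof -
  have "p > 0" using assms prime_gt_0_nat by blast
  have "{..p} = insert 0 (insert p {0<..<p})" by auto
  hence "(2 * p choose p) = 2 + (\<Sum>k\<in>{0<..<p}. (p choose k)\<^sup>2)"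
    using \<open>p > 0\<close> by (simp flip: choose_square_sum)
  moreover have "p\<^sup>2 dvd (\<Sum>k\<in>{0<..<p}. (p choose k)\<^sup>2)"
    by (rule dvd_sum) (use assms in \<open>auto intro!: dvd_power_same dvd_choose_prime\<close>)
  ultimately have "[2 * p choose p = 2] (mod p\<^sup>2)"
    by (metis cong_0_iff cong_add_lcancel_0_nat)
  hence "[int (2 * p choose p) = int 2] (mod int (p\<^sup>2))"
    by (simp only: cong_int_iff)
  thus ?thesis by simp
qed

text \<open>For \<open>f k = \<zeta>\<^sup>k\<close> this is \<open>(2 + \<zeta> + \<zeta>\<^sup>-\<^sup>1)\<^sup>N\<close>.\<close>

definition central_sum :: "nat \<Rightarrow> (int \<Rightarrow> int) \<Rightarrow> int" where
  "central_sum N f = (\<Sum>j\<le>2*N. int (2 * N choose j) * f (int j - int N))"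

text \<open>Pascal's rule moved onto the weight: lowering the row adds a shifted copy. Two
  applications give \<open>central_sum_Suc\<close>.\<close>

lemma sum_choose_Suc:
  fixes g :: "nat \<Rightarrow> int"
  shows "(\<Sum>j\<le>Suc n. int (Suc n choose j) * g j) = (\<Sum>j\<le>n. int (n choose j) * (g j + g (Suc j)))"
proof -
  have "(\<Sum>j\<le>Suc n. int (Suc n choose j) * g j)
      = g 0 + (\<Sum>j\<le>n. int (n choose j) * g (Suc j)) + (\<Sum>j\<le>n. int (n choose Suc j) * g (Suc j))"
    by (subst sum.atMost_Suc_shift) (simp add: algebra_simps sum.distrib)
  also have "g 0 + (\<Sum>j\<le>n. int (n choose Suc j) * g (Suc j)) = (\<Sum>j\<le>Suc n. int (n choose j) * g j)"
    by (subst sum.atMost_Suc_shift) simp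
  hence "g 0 + (\<Sum>j\<le>n. int (n choose j) * g (Suc j)) + (\<Sum>j\<le>n. int (n choose Suc j) * g (Suc j))
      = (\<Sum>j\<le>n. int (n choose j) * g (Suc j)) + (\<Sum>j\<le>n. int (n choose j) * g j)"
    by simp
  finally show ?thesis by (simp add: algebra_simps sum.distrib)
qed

text \<open>The operator on the weight is the general form of the factor 2 + \<zeta> + 1/\<zeta>. A
  finite family of weights closed under it satisfies a linear recursion in \<open>N\<close>.\<close>

lemma central_sum_Suc:
  "central_sum (Suc N) f = central_sum N (\<lambda>k. f (k - 1) + 2 * f k + f (k + 1))"
proof -
  have "central_sum (Suc N) f
      = (\<Sum>j\<le>Suc (Suc (2 * N)). int (Suc (Suc (2 * N)) choose j) * f (int j - int (Suc N)))"
    by (simp only: central_sum_def mult_Suc_right numeral_2_eq_2 add_Suc add_0)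
  also have "\<dots> = central_sum N (\<lambda>k. f (k - 1) + 2 * f k + f (k + 1))"
    unfolding sum_choose_Suc central_sum_def
    by (intro sum.cong refl) (simp add: algebra_simps)
  finally show ?thesis .
qed

lemma central_sum_0: "central_sum 0 f = f 0"
  by (simp add: central_sum_def)

lemma central_sum_linear:
  "central_sum N (\<lambda>k. a * f k + b * g k) = a * central_sum N f + b * central_sum N g"
  by (simp add: central_sum_def algebra_simps sum.distrib sum_distrib_left)

lemma sum_atMost_double:
  fixes g :: "nat \<Rightarrow> 'a::comm_monoid_add"
  shows "sum g {..2 * N} = g N + (\<Sum>i=1..N. g (N + i) + g (N - i))"
proof (induction N arbitrary: g)
  case (Suc N)
  have "sum g {..2 * Suc N} = sum g {..Suc (2 * N)} + g (2 * N + 2)" by simp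
  also have "sum g {..Suc (2 * N)} = g 0 + sum (g \<circ> Suc) {..2 * N}"
    by (subst sum.atMost_Suc_shift) simp
  also have "sum (g \<circ> Suc) {..2 * N} = g (Suc N) + (\<Sum>i=1..N. g (Suc N + i) + g (Suc N - i))"
    unfolding Suc.IH by (simp add: Suc_diff_le)
  finally show ?case by (simp add: mult_2 add_ac)
qed simp

definition recip_sum :: "nat \<Rightarrow> (nat \<Rightarrow> int) \<Rightarrow> nat \<Rightarrow> int" where
  "recip_sum p f M = (\<Sum>j=1..M. f j * recip p j)"

text \<open>Fold the sum about its middle term. Evenness of \<open>f\<close> makes the two terms at
  distance \<open>i\<close> equal, and only even \<open>i\<close> contribute; then
  \<open>p - i\<close> is odd and both the sign and \<open>recip p (p - i)\<close> are
  determined.\<close>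

lemma central_sum_prime_cong:
  assumes "prime p" "odd p"
    and even: "\<And>k. f (- k) = f k" and vanish: "\<And>k. odd k \<Longrightarrow> f k = 0"
  shows "[central_sum p f = 2 * f 0 - 4 * int p * recip_sum p (\<lambda>j. f (int j)) (p - 1)] (mod (int p)\<^sup>2)"
proof -
  have "p \<ge> 3" using assms(1,2) prime_ge_2_nat[of p] by (cases "p = 2") auto
  let ?g = "\<lambda>j. int (2 * p choose j) * f (int j - int p)"
  have t: "[?g (p + i) + ?g (p - i) = - 4 * int p * (f (int i) * recip p i)] (mod (int p)\<^sup>2)"
      (is "[?s = _] (mod _)") if i: "i \<in> {1..p-1}" for i
  proof (cases "even i")
    case False
    hence "f (int i) = 0" "f (int (p - i) - int p) = 0"
      using i vanish[of "int i"] even[of "int i"] by (auto simp: of_nat_diff)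
    thus ?thesis by simp
  next
    case True
    have "p + i \<le> 2 * p" "i \<le> p" using i by auto
    hence "(2 * p choose (p + i)) = (2 * p choose (p - i))"
      using binomial_symmetric[of "p + i" "2 * p"] by simp
    hence "?s = 2 * f (int i) * int (2 * p choose (p - i))"
      using \<open>i \<le> p\<close> even[of "int i"] by (simp add: of_nat_diff)
    also have "[2 * f (int i) * int (2 * p choose (p - i))
        = 2 * f (int i) * (- 2 * int p * ((-1) ^ (p - i) * recip p (p - i)))] (mod (int p)\<^sup>2)"
      by (intro cong_scalar_left choose_double_prime_cong) (use assms i in auto)
    also have "2 * f (int i) * (- 2 * int p * ((-1) ^ (p - i) * recip p (p - i)))
         = 4 * f (int i) * (int p * recip p (p - i))" using True \<open>odd p\<close> \<open>i \<le> p\<close> by simp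
    finally have s: "[?s = 4 * f (int i) * (int p * recip p (p - i))] (mod (int p)\<^sup>2)" .
    \<comment> \<open>The factor \<open>p\<close> raises the reflection of reciprocals from modulus
      \<open>p\<close> to modulus \<open>p\<^sup>2\<close>.\<close>
    have "[int p * recip p (p - i) = int p * - recip p i] (mod int p * int p)"
      using recip_diff_cong[of p i] \<open>p \<ge> 3\<close> \<open>odd p\<close> i
      by (auto simp: cong_iff_dvd_diff simp flip: right_diff_distrib distrib_left)
    hence "[4 * f (int i) * (int p * recip p (p - i)) = 4 * f (int i) * (int p * - recip p i)] (mod (int p)\<^sup>2)"
      unfolding power2_eq_square by (rule cong_scalar_left)
    hence "[?s = 4 * f (int i) * (int p * - recip p i)] (mod (int p)\<^sup>2)"
      by (rule cong_trans[OF s])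
    thus ?thesis by (simp add: ac_simps)
  qed
  \<comment> \<open>The outermost terms, at distance \<open>p\<close> from the centre, vanish
    because \<open>p\<close> is odd.\<close>
  have "f (int p) = 0" using vanish \<open>odd p\<close> by simp
  moreover have "{1..p} = insert p {1..p-1}" using \<open>p \<ge> 3\<close> by auto
  ultimately have s: "central_sum p f = int (2 * p choose p) * f 0 + (\<Sum>i=1..p-1. ?g (p + i) + ?g (p - i))"
    using \<open>p \<ge> 3\<close> even[of "int p"] by (simp add: central_sum_def sum_atMost_double)
  have "[central_sum p f = 2 * f 0 + (\<Sum>i=1..p-1. - 4 * int p * (f (int i) * recip p i))] (mod (int p)\<^sup>2)"
    unfolding s by (intro cong_add cong_sum t cong_scalar_right central_choose_prime_cong assms)
  thus ?thesis by (simp add: recip_sum_def sum_distrib_left sum_negf)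
qed

section \<open>Cosine weights and Pell numbers\<close>

text \<open>These are half the sum and half the difference of the cases \<zeta> = 1 and \<zeta> =
  -1, whose values are a power of 4 and 0.\<close>

lemma central_sum_even_odd:
  "central_sum (Suc N) (\<lambda>k. of_bool (even k)) = 2 * 4 ^ N \<and>
   central_sum (Suc N) (\<lambda>k. of_bool (odd k)) = 2 * 4 ^ N"
proof -
  have step: "central_sum (Suc N) (\<lambda>k. of_bool (even k)) = 2 * central_sum N (\<lambda>k. of_bool (even k)) + 2 * central_sum N (\<lambda>k. of_bool (odd k))"
    "central_sum (Suc N) (\<lambda>k. of_bool (odd k)) = 2 * central_sum N (\<lambda>k. of_bool (even k)) + 2 * central_sum N (\<lambda>k. of_bool (odd k))"
    for N
    unfolding central_sum_Suc central_sum_linear[symmetric]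
    by (auto intro!: arg_cong[where f = "central_sum N"])
  show ?thesis
    by (induction N) (simp_all add: step central_sum_0)
qed

text \<open>\<open>cos (k \<pi> / 2)\<close>; below, \<open>cos (k \<pi> / 4) = cos_eighth k + cos_eighth_irr k / \<surd>2\<close>.\<close>

definition cos_quarter :: "int \<Rightarrow> int" where
  "cos_quarter k = of_bool (k mod 4 = 0) - of_bool (k mod 4 = 2)"

text \<open>For \<zeta> = i the factor 2 + \<zeta> + 1/\<zeta> is 2: the two neighbours in the step
  cancel.\<close>

lemma central_sum_cos_quarter: "central_sum N cos_quarter = 2 ^ N"
proof (induction N)
  case (Suc N)
  \<comment> \<open>The zero summand gives the two-term shape required by
    \<open>central_sum_linear\<close>.\<close>
  have "cos_quarter (k - 1) + 2 * cos_quarter k + cos_quarter (k + 1) = 2 * cos_quarter k + 0 * cos_quarter k" for k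
  proof -
    have "(k + 1) mod 4 = 2 \<longleftrightarrow> (k - 1) mod 4 = 0" "(k + 1) mod 4 = 0 \<longleftrightarrow> (k - 1) mod 4 = 2"
      by presburger+
    thus ?thesis by (simp add: cos_quarter_def)
  qed
  hence "central_sum (Suc N) cos_quarter = 2 * central_sum N cos_quarter + 0 * central_sum N cos_quarter"
    by (simp only: central_sum_Suc central_sum_linear)
  thus ?case by (simp add: Suc.IH)
qed (simp add: central_sum_0 cos_quarter_def)

definition cos_eighth :: "int \<Rightarrow> int" where
  "cos_eighth k = of_bool (k mod 8 = 0) - of_bool (k mod 8 = 4)"

definition cos_eighth_irr :: "int \<Rightarrow> int" where
  "cos_eighth_irr k = of_bool (k mod 8 = 1) + of_bool (k mod 8 = 7) - of_bool (k mod 8 = 3) - of_bool (k mod 8 = 5)"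

text \<open>Order 8 has the factor 2 + sqrt 2. It sends \<open>a + b / sqrt 2\<close> to
  \<open>(2 * a + b) + (2 * a + 2 * b) / sqrt 2\<close>, which are the coefficients here.\<close>

lemma cos_eighth_step:
  "cos_eighth (k - 1) + 2 * cos_eighth k + cos_eighth (k + 1) = 2 * cos_eighth k + 1 * cos_eighth_irr k"
  "cos_eighth_irr (k - 1) + 2 * cos_eighth_irr k + cos_eighth_irr (k + 1) = 2 * cos_eighth k + 2 * cos_eighth_irr k"
proof -
  have shift: "(k + 1) mod 8 = (k mod 8 + 1) mod 8" "(k - 1) mod 8 = (k mod 8 - 1) mod 8"
    by (simp_all add: mod_simps)
  have "k mod 8 \<ge> 0" "k mod 8 < 8" by simp_all
  then consider "k mod 8 = 0" | "k mod 8 = 1" | "k mod 8 = 2" | "k mod 8 = 3"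
    | "k mod 8 = 4" | "k mod 8 = 5" | "k mod 8 = 6" | "k mod 8 = 7" by linarith
  hence "cos_eighth (k - 1) + 2 * cos_eighth k + cos_eighth (k + 1) = 2 * cos_eighth k + 1 * cos_eighth_irr k \<and>
    cos_eighth_irr (k - 1) + 2 * cos_eighth_irr k + cos_eighth_irr (k + 1) = 2 * cos_eighth k + 2 * cos_eighth_irr k"
    unfolding cos_eighth_def cos_eighth_irr_def shift
    by cases (simp_all only:, simp_all)
  thus "cos_eighth (k - 1) + 2 * cos_eighth k + cos_eighth (k + 1) = 2 * cos_eighth k + 1 * cos_eighth_irr k"
    "cos_eighth_irr (k - 1) + 2 * cos_eighth_irr k + cos_eighth_irr (k + 1) = 2 * cos_eighth k + 2 * cos_eighth_irr k"
    by simp_all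
qed

lemma central_sum_cos_eighth_Suc:
  "central_sum (Suc N) cos_eighth = 2 * central_sum N cos_eighth + 1 * central_sum N cos_eighth_irr"
  "central_sum (Suc N) cos_eighth_irr = 2 * central_sum N cos_eighth + 2 * central_sum N cos_eighth_irr"
  by (simp_all only: central_sum_Suc cos_eighth_step central_sum_linear)

text \<open>\<open>(1 + \<surd>2)\<^sup>m = half_pell_lucas m + pell m \<surd>2\<close>\<close>

definition half_pell_lucas :: "nat \<Rightarrow> int" where
  "half_pell_lucas m = int (pell (Suc m)) - int (pell m)"

lemma half_pell_lucas_0 [simp]: "half_pell_lucas 0 = 1"
  by (simp add: half_pell_lucas_def)

lemma pell_half_pell_lucas_Suc:
  "int (pell (Suc m)) = int (pell m) + half_pell_lucas m"
  "half_pell_lucas (Suc m) = 2 * int (pell m) + half_pell_lucas m"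
  by (simp_all add: half_pell_lucas_def)

text \<open>The norm equation for powers of 1 + sqrt 2, an element of norm -1.\<close>

lemma half_pell_lucas_square: "(half_pell_lucas m)\<^sup>2 = 2 * (int (pell m))\<^sup>2 + (-1) ^ m"
  by (induction m) (simp_all add: pell_half_pell_lucas_Suc power2_eq_square algebra_simps del: pell.simps(3))

text \<open>Since 2 + sqrt 2 = sqrt 2 * (1 + sqrt 2), its even powers are powers of 2 times even
  powers of 1 + sqrt 2. The irrational part is counted in units of 1 / sqrt 2, hence the extra
  factor 2.\<close>

lemma central_sum_cos_eighth_double:
  "central_sum (2 * m) cos_eighth = 2 ^ m * half_pell_lucas (2 * m) \<and>
   central_sum (2 * m) cos_eighth_irr = 2 ^ Suc m * int (pell (2 * m))"
proof (induction m)
  case 0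
  show ?case by (simp add: central_sum_0 cos_eighth_def cos_eighth_irr_def)
next
  case (Suc m)
  show ?case
    using Suc.IH
    by (simp add: central_sum_cos_eighth_Suc pell_half_pell_lucas_Suc algebra_simps del: pell.simps(3))
qed

text \<open>An odd exponent leaves one more sqrt 2, which exchanges rational and irrational parts
  and so brings in a Pell number.\<close>

lemma central_sum_cos_eighth_odd:
  "central_sum (Suc (2 * m)) cos_eighth = 2 ^ Suc m * int (pell (Suc (2 * m)))"
  using central_sum_cos_eighth_double[of m]
  by (simp add: central_sum_cos_eighth_Suc pell_half_pell_lucas_Suc algebra_simps)

text \<open>The rational part of \<open>\<surd>2\<^sup>j\<close>; its irrational part is half of \<open>sqrt2_power (Suc j)\<close>.\<close>

definition sqrt2_power :: "nat \<Rightarrow> int" where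
  "sqrt2_power j = (if even j then 2 ^ (j div 2) else 0)"

text \<open>The binomial expansion of \<open>(1 + sqrt 2) ^ N\<close>, split into its rational part
  and twice its irrational part.\<close>

lemma sum_choose_sqrt2_power:
  "(\<Sum>j\<le>N. int (N choose j) * sqrt2_power j) = half_pell_lucas N \<and>
   (\<Sum>j\<le>N. int (N choose j) * sqrt2_power (Suc j)) = 2 * int (pell N)"
proof (induction N)
  case (Suc N)
  have "sqrt2_power (Suc (Suc j)) = 2 * sqrt2_power j" for j
    by (simp add: sqrt2_power_def)
  thus ?case using Suc.IH
    by (simp only: sum_choose_Suc)
       (simp add: distrib_left sum.distrib pell_half_pell_lucas_Suc mult.left_commute[of _ 2] flip: sum_distrib_left)
qed (simp add: sqrt2_power_def)

lemma sum_choose_prime_cong: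
  fixes f :: "nat \<Rightarrow> int"
  assumes "prime p"
  shows "[(\<Sum>j\<le>p. int (p choose j) * f j) = f 0 + f p] (mod int p)"
proof -
  have "p > 0" using assms prime_gt_0_nat by blast
  hence "{..p} = insert 0 (insert p {0<..<p})" by auto
  hence "(\<Sum>j\<le>p. int (p choose j) * f j) = f 0 + f p + (\<Sum>j\<in>{0<..<p}. int (p choose j) * f j)"
    using \<open>p > 0\<close> by simp
  moreover have "int p dvd (\<Sum>j\<in>{0<..<p}. int (p choose j) * f j)"
    by (rule dvd_sum) (use assms in \<open>auto intro!: dvd_mult2 dvd_choose_prime\<close>)
  ultimately show ?thesis by (simp add: cong_iff_dvd_diff)
qed

text \<open>Frobenius: modulo \<open>p\<close> the power \<open>(1 + sqrt 2) ^ p\<close> is 1 plus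
  the \<open>p\<close>-th power of sqrt 2, which is purely irrational. The next lemma takes the
  irrational part.\<close>

lemma half_pell_lucas_prime_cong:
  assumes "prime p" "odd p"
  shows "[half_pell_lucas p = 1] (mod int p)"
  using sum_choose_prime_cong[OF assms(1), of sqrt2_power] assms(2)
  by (simp add: sum_choose_sqrt2_power) (simp add: sqrt2_power_def)

lemma pell_prime_cong:
  assumes "prime p" "odd p"
  shows "[int (pell p) = 2 ^ ((p - 1) div 2)] (mod int p)"
proof -
  obtain m where m: "p = Suc (2 * m)" using assms(2) by (auto elim: oddE)
  have "[2 * int (pell p) = 2 * 2 ^ m] (mod int p)"
    using sum_choose_prime_cong[OF assms(1), of "\<lambda>j. sqrt2_power (Suc j)"] 
    by (simp only: sum_choose_sqrt2_power) (simp add: sqrt2_power_def m del: pell.simps)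
  moreover have "coprime 2 (int p)" using assms(2) by simp
  ultimately have "[int (pell p) = 2 ^ m] (mod int p)"
    by (simp add: cong_mult_lcancel)
  thus ?thesis by (simp add: m)
qed

section \<open>Pell numbers near \<open>p\<close> modulo the square of \<open>p\<close>\<close>

lemma Legendre_2_prime:
  assumes "prime p" "odd p"
  shows "Legendre 2 (int p) = 1 \<or> Legendre 2 (int p) = -1"
proof -
  have "\<not> p dvd 2"
    using assms by (metis primes_dvd_imp_eq two_is_prime_nat even_numeral)
  hence "\<not> [2 = 0] (mod int p)"
    by (metis cong_0_iff int_dvd_int_iff of_nat_numeral)
  thus ?thesis by (simp add: Legendre_def)
qed

text \<open>In \<open>h\<^sup>2 - 1 = (h - e) * (h + e)\<close> the prime divides the first factor
  and hence not the second, since it does not divide \<open>2 * e\<close>. So the first factor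
  absorbs all of \<open>p\<^sup>2\<close>.\<close>

lemma dvd_square_cases:
  fixes h e :: int
  assumes "prime p" "odd p" "(int p)\<^sup>2 dvd h\<^sup>2 - 1" "int p dvd h - e" "e = 1 \<or> e = - 1"
  shows "(int p)\<^sup>2 dvd h - e"
proof -
  have f: "h\<^sup>2 - 1 = (h - e) * (h + e)"
    using assms(5) by (auto simp: power2_eq_square algebra_simps)
  have "\<not> int p dvd 2 * e"
  proof
    assume "int p dvd 2 * e"
    hence "int p dvd 2" using assms(5) by auto
    hence "p dvd 2" by (metis int_dvd_int_iff of_nat_numeral)
    thus False using assms by (metis primes_dvd_imp_eq two_is_prime_nat even_numeral)
  qed
  hence "\<not> int p dvd h + e"
    using assms(4) dvd_diff[of "int p" "h + e" "h - e"] by auto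
  hence "coprime ((int p)\<^sup>2) (h + e)"
    using assms(1) by (simp add: prime_imp_coprime)
  thus ?thesis using assms(3) unfolding f by (simp add: coprime_dvd_mult_left_iff)
qed

text \<open>The values of \<open>pell p\<close> and \<open>half_pell_lucas p\<close> modulo
  \<open>p\<close> force \<open>p\<close> to divide the Pell number at the even index p -
  \<epsilon>. There the norm equation fixes \<open>half_pell_lucas\<close> modulo
  \<open>p\<^sup>2\<close>, and one step of the recursion leads back to
  \<open>pell p\<close>.\<close>

lemma pell_prime_cong_square:
  assumes "prime p" "odd p"
  defines "\<epsilon> \<equiv> Legendre 2 (int p)"
  shows "int p dvd int (pell (nat (int p - \<epsilon>)))"
    and "[int (pell p) = \<epsilon> * (1 + int (pell (nat (int p - \<epsilon>))))] (mod (int p)\<^sup>2)"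
proof -
  have "p \<ge> 3" using assms(1,2) prime_ge_2_nat[of p] by (cases "p = 2") auto
  then obtain r where r: "p = Suc r" by (cases p) auto
  have "even r" "even (Suc p)" using assms(2) r by simp_all
  have "[\<epsilon> = 2 ^ ((p - 1) div 2)] (mod int p)"
    unfolding \<epsilon>_def using euler_criterion[of p 2] assms(1) \<open>p \<ge> 3\<close> by simp
  hence P: "int p dvd int (pell p) - \<epsilon>"
    using pell_prime_cong[OF assms(1,2)] by (meson cong_iff_dvd_diff cong_sym cong_trans)
  have H: "int p dvd half_pell_lucas p - 1"
    using half_pell_lucas_prime_cong[OF assms(1,2)] by (simp add: cong_iff_dvd_diff)
  \<comment> \<open>At an even index the norm is +1, and a Pell number divisible by \<open>p\<close>
    enters it squared.\<close>
  have sq: "(int p)\<^sup>2 dvd (half_pell_lucas m)\<^sup>2 - 1" if "int p dvd int (pell m)" "even m" for m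
  proof -
    have "(half_pell_lucas m)\<^sup>2 - 1 = 2 * (int (pell m))\<^sup>2"
      using that(2) by (simp add: half_pell_lucas_square)
    thus ?thesis using that(1) by (simp add: dvd_mult dvd_power_same)
  qed
  have "int p dvd int (pell (nat (int p - \<epsilon>))) \<and>
      [int (pell p) = \<epsilon> * (1 + int (pell (nat (int p - \<epsilon>))))] (mod (int p)\<^sup>2)"
    using Legendre_2_prime[OF assms(1,2)] unfolding \<epsilon>_def[symmetric]
  proof
    assume e: "\<epsilon> = 1"
    hence n: "nat (int p - \<epsilon>) = r" using r by simp
    have "int (pell r) = (half_pell_lucas p - 1) - (int (pell p) - \<epsilon>)"
      by (simp add: r e pell_half_pell_lucas_Suc del: pell.simps)
    hence d: "int p dvd int (pell r)" using dvd_diff[OF H P] by simp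
    have h: "half_pell_lucas r = int (pell p) - int (pell r)" by (simp add: r half_pell_lucas_def)
    have "half_pell_lucas r - \<epsilon> = (int (pell p) - \<epsilon>) - int (pell r)" by (simp add: h)
    hence "int p dvd half_pell_lucas r - \<epsilon>" using dvd_diff[OF P d] by argo
    hence "(int p)\<^sup>2 dvd half_pell_lucas r - \<epsilon>"
      by (rule dvd_square_cases[OF assms(1,2) sq[OF d \<open>even r\<close>]]) (simp add: e)
    thus ?thesis using d unfolding n by (simp add: e h cong_iff_dvd_diff algebra_simps)
  next
    assume e: "\<epsilon> = -1"
    hence n: "nat (int p - \<epsilon>) = Suc p" by simp
    have "int (pell (Suc p)) = (half_pell_lucas p - 1) + (int (pell p) - \<epsilon>)"
      by (simp add: e pell_half_pell_lucas_Suc del: pell.simps)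
    hence d: "int p dvd int (pell (Suc p))" using dvd_add[OF H P] by simp
    have h: "half_pell_lucas (Suc p) = int (pell p) + int (pell (Suc p))"
      by (simp add: pell_half_pell_lucas_Suc del: pell.simps)
    have "half_pell_lucas (Suc p) - \<epsilon> = (int (pell p) - \<epsilon>) + int (pell (Suc p))" by (simp add: h)
    hence "int p dvd half_pell_lucas (Suc p) - \<epsilon>" using dvd_add[OF P d] by argo
    hence "(int p)\<^sup>2 dvd half_pell_lucas (Suc p) - \<epsilon>"
      by (rule dvd_square_cases[OF assms(1,2) sq[OF d \<open>even (Suc p)\<close>]]) (simp add: e)
    thus ?thesis using d unfolding n by (simp add: e h cong_iff_dvd_diff algebra_simps del: pell.simps)
  qed
  thus "int p dvd int (pell (nat (int p - \<epsilon>)))"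
    and "[int (pell p) = \<epsilon> * (1 + int (pell (nat (int p - \<epsilon>))))] (mod (int p)\<^sup>2)" by auto
qed

section \<open>Reciprocal sums over residue classes\<close>

lemma recip_sum_cong:
  "(\<And>j. 1 \<le> j \<Longrightarrow> j \<le> M \<Longrightarrow> f j = g j) \<Longrightarrow> recip_sum p f M = recip_sum p g M"
  by (auto simp: recip_sum_def intro!: sum.cong)

lemma recip_sum_add: "recip_sum p (\<lambda>j. f j + g j) M = recip_sum p f M + recip_sum p g M"
  by (simp add: recip_sum_def sum.distrib distrib_right)

lemma recip_sum_diff: "recip_sum p (\<lambda>j. f j - g j) M = recip_sum p f M - recip_sum p g M"
  by (simp add: recip_sum_def sum_subtractf left_diff_distrib)

lemma recip_sum_mult: "recip_sum p (\<lambda>j. c * f j) M = c * recip_sum p f M"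
  by (simp add: recip_sum_def sum_distrib_left mult.assoc)

text \<open>Only even indices survive; substituting \<open>j = 2 * i\<close> is an exact equality
  because \<open>recip\<close> is exactly multiplicative.\<close>

lemma recip_sum_double:
  assumes "\<And>j. odd j \<Longrightarrow> f j = 0"
  shows "recip_sum p f (2 * K) = recip p 2 * recip_sum p (\<lambda>i. f (2 * i)) K"
proof (induction K)
  case (Suc K)
  have "recip_sum p f (2 * Suc K) = recip_sum p f (2 * K) + f (2 * Suc K) * recip p (2 * Suc K)"
    by (simp add: recip_sum_def assms)
  also have "recip p (2 * Suc K) = recip p 2 * recip p (Suc K)"
    by (rule recip_mult)
  finally show ?case unfolding Suc.IH by (simp add: recip_sum_def algebra_simps)
qed (simp add: recip_sum_def)

text \<open>The indices above \<open>K\<close> are reflected by \<open>j\<close> to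
  \<open>p - j\<close> into \<open>1..K\<close>, where each reciprocal changes sign.\<close>

lemma recip_sum_reflect:
  assumes "p = Suc (2 * K)" "K > 0"
  shows "[recip_sum p f (p - 1) = recip_sum p f K - recip_sum p (\<lambda>i. f (p - i)) K] (mod int p)"
proof -
  have "{1..p-1} = {1..K} \<union> {K<..2*K}" using assms by auto
  hence "recip_sum p f (p - 1) = recip_sum p f K + (\<Sum>j\<in>{K<..2*K}. f j * recip p j)"
    unfolding recip_sum_def by (simp add: sum.union_disjoint ivl_disj_int)
  also have "(\<Sum>j\<in>{K<..2*K}. f j * recip p j) = (\<Sum>i=1..K. f (p - i) * recip p (p - i))"
    by (rule sum.reindex_bij_witness[of _ "\<lambda>i. p - i" "\<lambda>j. p - j"]) (use assms in auto)
  also have "[recip_sum p f K + \<dots> = recip_sum p f K + (\<Sum>i=1..K. f (p - i) * - recip p i)] (mod int p)"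
    by (intro cong_add cong_refl cong_sum cong_scalar_left recip_diff_cong) (use assms in auto)
  finally show ?thesis by (simp add: recip_sum_def sum_negf)
qed

lemma recip_sum_reflect_full:
  assumes "odd p" "p \<ge> 3"
  shows "[recip_sum p f (p - 1) = - recip_sum p (\<lambda>i. f (p - i)) (p - 1)] (mod int p)"
proof -
  have "recip_sum p f (p - 1) = (\<Sum>i=1..p-1. f (p - i) * recip p (p - i))"
    unfolding recip_sum_def
    by (rule sum.reindex_bij_witness[of _ "\<lambda>i. p - i" "\<lambda>j. p - j"]) (use assms in auto)
  also have "[\<dots> = (\<Sum>i=1..p-1. f (p - i) * - recip p i)] (mod int p)"
    by (intro cong_sum cong_scalar_left recip_diff_cong) (use assms in auto)
  finally show ?thesis by (simp add: recip_sum_def sum_negf)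
qed

definition class_sum :: "nat \<Rightarrow> nat \<Rightarrow> nat \<Rightarrow> int" where
  "class_sum p r M = recip_sum p (\<lambda>j. of_bool (j mod 4 = r)) M"

text \<open>Used to compare the coefficients of \<open>p\<close> in two first-order
  expansions.\<close>

lemma cong_square_cancel:
  fixes x y :: int
  assumes "p > 0" "[a + int p * x = a + int p * y] (mod (int p)\<^sup>2)"
  shows "[x = y] (mod int p)"
proof -
  have "int p * int p dvd int p * (x - y)"
    using assms(2) by (simp add: cong_iff_dvd_diff power2_eq_square algebra_simps)
  thus ?thesis using assms(1) by (simp add: cong_iff_dvd_diff)
qed

lemma of_nat_mod_eq_iff: "int j mod numeral k = numeral r \<longleftrightarrow> j mod numeral k = numeral r"
  "int j mod numeral k = 0 \<longleftrightarrow> j mod numeral k = 0"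
  by (metis of_nat_eq_iff of_nat_mod of_nat_numeral of_nat_0)+

section \<open>Class sums modulo \<open>p\<close> in terms of the Fermat and Pell quotients\<close>

context
  fixes p K :: nat and q :: int
  assumes p: "prime p" and K: "p = Suc (2 * K)" "K > 0"
    and q: "2 ^ (p - 1) = 1 + int p * q"
begin

lemma odd_p: "odd p" and p_ge_3: "p \<ge> 3" and p_pos: "p > 0"
  using K by auto

lemma cong_2_cancel: "[2 * x = 2 * y] (mod int p) \<longleftrightarrow> [x = y] (mod int p)"
  using odd_p by (simp add: cong_mult_lcancel)

text \<open>The parity weight has central sum twice the square of \<open>2 ^ (p - 1)\<close>, that
  is \<open>2 * (1 + int p * q)\<^sup>2\<close>; compare with
  \<open>central_sum_prime_cong\<close>.\<close>

lemma class_sum_even_cong: "[class_sum p 0 (p - 1) + class_sum p 2 (p - 1) = - q] (mod int p)"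
proof -
  let ?R = "class_sum p 0 (p - 1) + class_sum p 2 (p - 1)"
  have R: "recip_sum p (\<lambda>j. of_bool (even (int j))) (p - 1) = ?R"
    unfolding class_sum_def recip_sum_add[symmetric]
  proof (rule recip_sum_cong)
    fix j :: nat
    have "even j \<longleftrightarrow> j mod 4 = 0 \<or> j mod 4 = 2" by presburger
    thus "of_bool (even (int j)) = of_bool (j mod 4 = 0) + (of_bool (j mod 4 = 2) :: int)" by auto
  qed
  have "2 * (2 ^ (p - 1))\<^sup>2 = central_sum p (\<lambda>k. of_bool (even k))"
    using central_sum_even_odd[of "2 * K"] by (simp add: K(1) power_mult[symmetric] mult.commute[of K] power_even_eq[of 2 "2 * K"] flip: power_mult)
       (simp add: power_mult)
  also have "[\<dots> = 2 * of_bool (even (0::int)) - 4 * int p * ?R] (mod (int p)\<^sup>2)"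
    unfolding R[symmetric] by (rule central_sum_prime_cong) (use p odd_p in auto)
  finally have "[2 + int p * (4 * q) + (int p)\<^sup>2 * (2 * q\<^sup>2) = 2 + int p * (- 4 * ?R)] (mod (int p)\<^sup>2)"
    unfolding q by (simp add: power2_eq_square algebra_simps)
  hence "[2 + int p * (4 * q) = 2 + int p * (- 4 * ?R)] (mod (int p)\<^sup>2)"
    by (simp add: cong_iff_dvd_diff diff_add_eq[symmetric] dvd_add_left_iff)
  hence "[4 * q = - 4 * ?R] (mod int p)" by (rule cong_square_cancel[OF p_pos])
  hence "[2 * (2 * q) = 2 * (2 * - ?R)] (mod int p)" by simp
  hence "[q = - ?R] (mod int p)" unfolding cong_2_cancel .
  thus ?thesis by (metis cong_minus_minus_iff cong_sym minus_minus)
qed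

text \<open>The case of order 4: the central sum is
  \<open>2 ^ p = 2 + int p * (2 * q)\<close>.\<close>

lemma class_sum_alternating_cong:
  "[2 * (class_sum p 0 (p - 1) - class_sum p 2 (p - 1)) = - q] (mod int p)"
proof -
  let ?R = "class_sum p 0 (p - 1) - class_sum p 2 (p - 1)"
  have R: "recip_sum p (\<lambda>j. cos_quarter (int j)) (p - 1) = ?R"
    unfolding class_sum_def recip_sum_diff[symmetric]
    by (rule recip_sum_cong) (simp add: cos_quarter_def of_nat_mod_eq_iff)
  have "2 + int p * (2 * q) = central_sum p cos_quarter"
    using q by (simp add: central_sum_cos_quarter K(1) algebra_simps)
  also have "[\<dots> = 2 * cos_quarter 0 - 4 * int p * ?R] (mod (int p)\<^sup>2)"
    unfolding R[symmetric]
  proof (rule central_sum_prime_cong)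
    fix k :: int
    have "(- k) mod 4 = 0 \<longleftrightarrow> k mod 4 = 0" "(- k) mod 4 = 2 \<longleftrightarrow> k mod 4 = 2" by presburger+
    thus "cos_quarter (- k) = cos_quarter k" by (simp add: cos_quarter_def)
    assume "odd k"
    hence "k mod 4 \<noteq> 0" "k mod 4 \<noteq> 2" by presburger+
    thus "cos_quarter k = 0" by (simp add: cos_quarter_def)
  qed (use p odd_p in auto)
  finally have "[2 + int p * (2 * q) = 2 + int p * (- 4 * ?R)] (mod (int p)\<^sup>2)"
    by (simp add: cos_quarter_def algebra_simps)
  hence "[2 * q = - 4 * ?R] (mod int p)" by (rule cong_square_cancel[OF p_pos])
  hence "[2 * q = 2 * (- (2 * ?R))] (mod int p)" by simp
  hence "[q = - (2 * ?R)] (mod int p)" unfolding cong_2_cancel .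
  thus ?thesis by (metis cong_minus_minus_iff cong_sym minus_minus)
qed

lemma recip_2_cong: "[2 * (recip p 2 * x) = x] (mod int p)"
proof -
  have "\<not> p dvd 2"
    using p odd_p by (metis primes_dvd_imp_eq two_is_prime_nat even_numeral)
  hence "[int 2 * recip p 2 = 1] (mod int p)" by (rule mult_recip_cong[OF p])
  from cong_scalar_right[OF this, of x] show ?thesis by (simp add: mult.assoc)
qed

text \<open>The multiples of 4 below \<open>p\<close> are the doubles of the even numbers up to
  \<open>K\<close>.\<close>

lemma class_sum_half_cong:
  "[2 * class_sum p 0 (p - 1) = class_sum p 0 K + class_sum p 2 K] (mod int p)"
proof -
  have "class_sum p 0 (p - 1) = recip p 2 * recip_sum p (\<lambda>i. of_bool (2 * i mod 4 = 0)) K"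
    unfolding class_sum_def K(1) diff_Suc_1 by (rule recip_sum_double) (simp, presburger)
  also have "recip_sum p (\<lambda>i. of_bool (2 * i mod 4 = 0)) K = class_sum p 0 K + class_sum p 2 K"
    unfolding class_sum_def recip_sum_add[symmetric]
  proof (rule recip_sum_cong)
    fix j :: nat
    have "2 * j mod 4 = 0 \<longleftrightarrow> j mod 4 = 0 \<or> j mod 4 = 2" by presburger
    thus "of_bool (2 * j mod 4 = 0) = of_bool (j mod 4 = 0) + (of_bool (j mod 4 = 2) :: int)" by auto
  qed
  finally show ?thesis using recip_2_cong by simp
qed

text \<open>On multiples of 4 the weight is twice the indicator of multiples of 8, minus 1;
  multiples of 8 below \<open>p\<close> are the doubles of multiples of 4 up to
  \<open>K\<close>.\<close>

lemma recip_sum_cos_eighth_cong: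
  "[recip_sum p (\<lambda>j. cos_eighth (int j)) (p - 1) = class_sum p 0 K - class_sum p 0 (p - 1)] (mod int p)"
proof -
  let ?R = "recip_sum p (\<lambda>j. of_bool (j mod 8 = 0)) (p - 1)"
  have "recip_sum p (\<lambda>j. cos_eighth (int j)) (p - 1) = 2 * ?R - class_sum p 0 (p - 1)"
    unfolding class_sum_def recip_sum_diff[symmetric] recip_sum_mult[symmetric]
  proof (rule recip_sum_cong)
    fix j :: nat
    have "j mod 4 = 0 \<longleftrightarrow> j mod 8 = 0 \<or> j mod 8 = 4" by presburger
    thus "cos_eighth (int j) = 2 * of_bool (j mod 8 = 0) - of_bool (j mod 4 = 0)"
      by (auto simp: cos_eighth_def of_nat_mod_eq_iff)
  qed
  moreover have "?R = recip p 2 * recip_sum p (\<lambda>i. of_bool (2 * i mod 8 = 0)) K"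
    unfolding K(1) diff_Suc_1 by (rule recip_sum_double) (simp, presburger)
  moreover have "recip_sum p (\<lambda>i. of_bool (2 * i mod 8 = 0)) K = class_sum p 0 K"
    unfolding class_sum_def
  proof (rule recip_sum_cong)
    fix j :: nat
    have "2 * j mod 8 = 0 \<longleftrightarrow> j mod 4 = 0" by presburger
    thus "of_bool (2 * j mod 8 = 0) = (of_bool (j mod 4 = 0) :: int)" by simp
  qed
  ultimately show ?thesis
    using cong_diff[OF recip_2_cong cong_refl, of "class_sum p 0 K" "class_sum p 0 (p - 1)"] by simp
qed

text \<open>The case of order 8, with central sum \<open>2 ^ (K + 1) * pell p\<close>. Both
  \<open>2 ^ K\<close> and \<open>pell p\<close> are \<epsilon> times a number congruent to 1 modulo
  \<open>p\<close>, so the signs cancel and the first-order terms add.\<close>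

lemma class_sum_pell_cong:
  assumes c: "int (pell (nat (int p - Legendre 2 (int p)))) = int p * c"
  shows "[2 * c + q = - 4 * (class_sum p 0 K - class_sum p 0 (p - 1))] (mod int p)"
proof -
  define \<epsilon> where "\<epsilon> = Legendre 2 (int p)"
  have e: "\<epsilon> * \<epsilon> = 1" using Legendre_2_prime[OF p odd_p] by (auto simp: \<epsilon>_def)
  define E where "E = recip_sum p (\<lambda>j. cos_eighth (int j)) (p - 1)"
  \<comment> \<open>Euler's criterion lets \<open>2 ^ K\<close> be written as \<epsilon> times
    \<open>1 + int p * s\<close>; squaring then identifies \<open>2 * s\<close> with
    \<open>q\<close> modulo \<open>p\<close>.\<close>
  have "[\<epsilon> = 2 ^ K] (mod int p)"
    using euler_criterion[of p 2] p p_ge_3 K by (simp add: \<epsilon>_def)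
  then obtain s' where s': "2 ^ K = \<epsilon> + int p * s'"
    by (metis cong_iff_lin)
  define s where "s = \<epsilon> * s'"
  have s: "2 ^ K = \<epsilon> * (1 + int p * s)"
    by (simp add: s_def s' distrib_left e mult.left_commute[of \<epsilon>] flip: mult.assoc)
  have "1 + int p * q = (2 ^ K)\<^sup>2"
    using q by (simp add: K(1) power_mult mult.commute[of 2 K])
  also have "\<dots> = 1 + int p * (2 * s) + (int p)\<^sup>2 * s\<^sup>2"
    unfolding s power_mult_distrib using e by (simp add: power2_eq_square algebra_simps)
  finally have "[1 + int p * q = 1 + int p * (2 * s)] (mod (int p)\<^sup>2)"
    by (simp add: cong_iff_dvd_diff)
  hence qs: "[q = 2 * s] (mod int p)" by (rule cong_square_cancel[OF p_pos])

  have "[2 * (2 ^ K * int (pell p)) = 2 * (2 ^ K * (\<epsilon> * (1 + int p * c)))] (mod (int p)\<^sup>2)"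
    using pell_prime_cong_square(2)[OF p odd_p] unfolding c unfolding \<epsilon>_def
    by (intro cong_scalar_left)
  also have "2 * (2 ^ K * (\<epsilon> * (1 + int p * c))) = 2 * (\<epsilon> * \<epsilon>) * ((1 + int p * s) * (1 + int p * c))"
    unfolding s by (simp only: ac_simps)
  also have "\<dots> = 2 + int p * (2 * s + 2 * c) + (int p)\<^sup>2 * (2 * s * c)"
    by (simp add: e power2_eq_square algebra_simps)
  finally have A: "[2 * (2 ^ K * int (pell p)) = 2 + int p * (2 * s + 2 * c)] (mod (int p)\<^sup>2)"
    by (simp add: cong_iff_dvd_diff diff_diff_eq[symmetric] dvd_diff_left_iff)
  have "2 * (2 ^ K * int (pell p)) = central_sum p cos_eighth"
    using central_sum_cos_eighth_odd[of K] by (simp add: K(1) del: pell.simps)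
  also have "[\<dots> = 2 * cos_eighth 0 - 4 * int p * E] (mod (int p)\<^sup>2)"
    unfolding E_def
  proof (rule central_sum_prime_cong)
    fix k :: int
    have "(- k) mod 8 = 0 \<longleftrightarrow> k mod 8 = 0" "(- k) mod 8 = 4 \<longleftrightarrow> k mod 8 = 4" by presburger+
    thus "cos_eighth (- k) = cos_eighth k" by (simp add: cos_eighth_def)
    assume "odd k"
    hence "k mod 8 \<noteq> 0" "k mod 8 \<noteq> 4" by presburger+
    thus "cos_eighth k = 0" by (simp add: cos_eighth_def)
  qed (use p odd_p in auto)
  also have "2 * cos_eighth 0 - 4 * int p * E = 2 + int p * (- 4 * E)"
    by (simp add: cos_eighth_def)
  finally have "[2 + int p * (2 * s + 2 * c) = 2 + int p * (- 4 * E)] (mod (int p)\<^sup>2)"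
    by (rule cong_trans[OF cong_sym[OF A]])
  hence "[2 * s + 2 * c = - 4 * E] (mod int p)" by (rule cong_square_cancel[OF p_pos])
  also have "[- 4 * E = - 4 * (class_sum p 0 K - class_sum p 0 (p - 1))] (mod int p)"
    unfolding E_def by (intro cong_scalar_left recip_sum_cos_eighth_cong)
  finally have "[2 * s + 2 * c = - 4 * (class_sum p 0 K - class_sum p 0 (p - 1))] (mod int p)" .
  moreover have "[2 * c + q = 2 * s + 2 * c] (mod int p)"
    using cong_add[OF cong_refl qs, of "2 * c"] by (simp add: ac_simps)
  ultimately show ?thesis by (rule cong_trans[rotated])
qed

text \<open>For \<open>r\<close> even and \<open>r'\<close> odd this transfers the known sums over
  even classes to the odd classes, up to \<open>K\<close> and up to \<open>p - 1\<close>
  respectively.\<close>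

lemma class_sum_reflect:
  assumes "\<And>i. i \<le> p \<Longrightarrow> (p - i) mod 4 = r \<longleftrightarrow> i mod 4 = r'"
  shows "[class_sum p r (p - 1) = class_sum p r K - class_sum p r' K] (mod int p)"
    and "[class_sum p r (p - 1) = - class_sum p r' (p - 1)] (mod int p)"
proof -
  have e: "recip_sum p (\<lambda>i. of_bool ((p - i) mod 4 = r)) M = class_sum p r' M" if "M \<le> p" for M
    unfolding class_sum_def by (rule recip_sum_cong) (use assms that in auto)
  show "[class_sum p r (p - 1) = class_sum p r K - class_sum p r' K] (mod int p)"
    using recip_sum_reflect[OF K, of "\<lambda>j. of_bool (j mod 4 = r)"] e[of K] K
    by (simp add: class_sum_def)
  show "[class_sum p r (p - 1) = - class_sum p r' (p - 1)] (mod int p)"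
    using recip_sum_reflect_full[OF odd_p p_ge_3, of "\<lambda>j. of_bool (j mod 4 = r)"] e[of "p - 1"] K
    by (simp add: class_sum_def)
qed

end

section \<open>Quadrinomial coefficients\<close>

text \<open>Coefficients of \<open>x ^ k\<close> on both sides of (1 - x) F^(m+1) = (1 - x^4)
  F^m.\<close>

lemma quadrinomial_diff:
  "quadrinomial (Suc m) k - (if k = 0 then 0 else quadrinomial (Suc m) (k - 1))
     = quadrinomial m k - (if k < 4 then 0 else quadrinomial m (k - 4))"
proof -
  let ?F = "[:1, 1, 1, 1::int:]"
  have "(1 - Polynomial.monom 1 1) * ?F = 1 - Polynomial.monom 1 4"
    by (simp add: monom_Suc numeral_eq_Suc monom_0 one_pCons)
  hence "(1 - Polynomial.monom 1 1) * ?F ^ Suc m = (1 - Polynomial.monom 1 4) * ?F ^ m"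
    by (simp only: power_Suc mult.assoc[symmetric])
  hence "Polynomial.coeff ((1 - Polynomial.monom 1 1) * ?F ^ Suc m) k = Polynomial.coeff ((1 - Polynomial.monom 1 4) * ?F ^ m) k"
    by simp
  thus ?thesis
    by (auto simp: left_diff_distrib coeff_monom_mult quadrinomial_def not_less simp del: power_Suc)
qed

text \<open>The coefficient of \<open>x\<^sup>k\<^sup>-\<^sup>j\<close> in \<open>1 / F = (1 - x) / (1 - x\<^sup>4)\<close>.\<close>

definition class_weight :: "nat \<Rightarrow> nat \<Rightarrow> int" where
  "class_weight k j = of_bool (j mod 4 = k mod 4) - of_bool (Suc j mod 4 = k mod 4)"

text \<open>This is F^m = F^(m+1) / F. The induction goes from \<open>k - 4\<close> to
  \<open>k\<close> through \<open>quadrinomial_diff\<close>.\<close>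

lemma quadrinomial_eq_sum:
  "quadrinomial m k = (\<Sum>j\<le>k. class_weight k j * quadrinomial (Suc m) j)"
proof (induction k rule: less_induct)
  case (less k)
  consider "k = 0" | "k = Suc 0" | "k = Suc (Suc 0)" | "k = Suc (Suc (Suc 0))"
    | i where "k = Suc (Suc (Suc (Suc i)))"
    by (metis not0_implies_Suc)
  thus ?case
  proof cases
    case (5 i)
    \<comment> \<open>The weight depends on \<open>k\<close> modulo 4 only, so the sums for
      \<open>k\<close> and \<open>i = k - 4\<close> differ in the last four terms, whose weights are
      0, 0, -1, 1.\<close>
    have "k mod 4 = i mod 4" unfolding 5 by presburger
    hence "class_weight k = class_weight i"
      by (simp add: fun_eq_iff class_weight_def)
    moreover have "i mod 4 < 4" by simp
    then consider "i mod 4 = 0" | "i mod 4 = 1" | "i mod 4 = 2" | "i mod 4 = 3" by linarith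
    hence "class_weight i (Suc i) = 0 \<and> class_weight i (Suc (Suc i)) = 0 \<and>
      class_weight i (Suc (Suc (Suc i))) = -1 \<and> class_weight i k = 1"
      unfolding class_weight_def 5 by cases (simp_all add: mod_Suc)
    ultimately show ?thesis
      using quadrinomial_diff[of m k] less.IH[of i] by (simp add: 5)
  qed (use quadrinomial_diff[of m 0] quadrinomial_diff[of m "Suc 0"] quadrinomial_diff[of m "Suc (Suc 0)"]
        quadrinomial_diff[of m "Suc (Suc (Suc 0))"] in \<open>simp_all add: class_weight_def mod_Suc\<close>)
qed

text \<open>Coefficients in (F^(m+1))' = (m+1) F^m F', where F' = 1 + 2x + 3x^2.\<close>

lemma quadrinomial_deriv:
  "int (Suc k) * quadrinomial (Suc m) (Suc k) = int (Suc m) *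
     (quadrinomial m k + (if k < 1 then 0 else 2 * quadrinomial m (k - 1))
       + (if k < 2 then 0 else 3 * quadrinomial m (k - 2)))"
proof -
  let ?F = "[:1, 1, 1, 1::int:]"
  have "pderiv ?F = 1 + Polynomial.monom 2 1 + Polynomial.monom 3 2"
    by (simp add: pderiv_pCons monom_Suc numeral_eq_Suc monom_0 one_pCons)
  hence "pderiv (?F ^ Suc m) = Polynomial.smult (int (Suc m)) (?F ^ m + Polynomial.monom 2 1 * ?F ^ m + Polynomial.monom 3 2 * ?F ^ m)"
    by (simp only: pderiv_power_Suc of_nat_id) (simp add: algebra_simps)
  hence "Polynomial.coeff (pderiv (?F ^ Suc m)) k
      = Polynomial.coeff (Polynomial.smult (int (Suc m)) (?F ^ m + Polynomial.monom 2 1 * ?F ^ m + Polynomial.monom 3 2 * ?F ^ m)) k"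
    by simp
  thus ?thesis
    by (auto simp: coeff_pderiv coeff_monom_mult quadrinomial_def not_less simp del: power_Suc of_nat_Suc)
qed

text \<open>Coefficients of F'/F = 1/(1 - x) - 4x^3/(1 - x^4), as \<open>class_weight k 0\<close> is
  the coefficient of \<open>x ^ k\<close> in 1/F.\<close>

lemma class_weight_deriv:
  "class_weight k 0 + (if k < 1 then 0 else 2 * class_weight (k - 1) 0)
     + (if k < 2 then 0 else 3 * class_weight (k - 2) 0) = 1 - 4 * of_bool (Suc k mod 4 = 0)"
proof -
  consider "k = 0" | "k = 1" | i where "k = Suc (Suc i)"
    by (metis One_nat_def not0_implies_Suc)
  thus ?thesis
  proof cases
    case (3 i)
    have "i mod 4 < 4" by simp
    then consider "i mod 4 = 0" | "i mod 4 = 1" | "i mod 4 = 2" | "i mod 4 = 3" by linarith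
    thus ?thesis unfolding class_weight_def 3 by cases (simp_all add: mod_Suc)
  qed (simp_all add: class_weight_def)
qed

lemma quadrinomial_0_right: "quadrinomial N 0 = 1"
  by (simp add: quadrinomial_def coeff_0_power)

lemma sum_atMost_split: "(\<Sum>j\<le>k. f j) = f 0 + (\<Sum>j=1..k. f j)" for f :: "nat \<Rightarrow> int"
  by (simp add: atMost_atLeast0 sum.atLeast_Suc_atMost)

section \<open>Quadrinomial coefficients in row \<open>n * p - 1\<close> modulo \<open>p\<close> and
  its square\<close>

context
  fixes p n m :: nat
  assumes p: "prime p" and m: "n * p = Suc m"
begin

lemma dvd_quadrinomial:
  assumes "0 < k" "k < p"
  shows "int p dvd quadrinomial (Suc m) k"
proof -
  obtain i where k: "k = Suc i" using assms(1) gr0_implies_Suc by blast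
  have "int p dvd int (Suc m)" using m by (metis dvd_triv_right int_dvd_int_iff)
  hence "int p dvd int k * quadrinomial (Suc m) k"
    unfolding k quadrinomial_deriv by (rule dvd_mult2)
  moreover have "\<not> int p dvd int k"
    using assms by (simp add: nat_dvd_not_less)
  ultimately show ?thesis using p prime_dvd_mult_iff by (metis prime_nat_int_transfer)
qed

text \<open>Modulo \<open>p\<close> and \<open>x ^ p\<close> the power F^(np) is 1, so F^m is
  1/F.\<close>

lemma quadrinomial_cong_prime:
  assumes "k < p"
  shows "[quadrinomial m k = class_weight k 0] (mod int p)"
proof -
  have "[(\<Sum>j=1..k. class_weight k j * quadrinomial (Suc m) j) = 0] (mod int p)"
    unfolding cong_0_iff
    by (intro dvd_sum dvd_mult dvd_quadrinomial) (use assms in auto)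
  thus ?thesis
    unfolding quadrinomial_eq_sum[of m] sum_atMost_split quadrinomial_0_right
    using cong_add[OF cong_refl, of _ 0 "int p" "class_weight k 0"] by simp
qed

text \<open>The coefficient of np log F. After cancelling \<open>p\<close> from the derivative
  identity, F^m is needed only modulo \<open>p\<close>; there it is 1/F, and F'/F appears.\<close>

lemma quadrinomial_Suc_cong_square:
  assumes "0 < k" "k < p"
  shows "[quadrinomial (Suc m) k = int n * int p * ((1 - 4 * of_bool (k mod 4 = 0)) * recip p k)] (mod (int p)\<^sup>2)"
proof -
  obtain i where k: "k = Suc i" using assms(1) gr0_implies_Suc by blast
  have "\<not> p dvd k" using assms by (simp add: nat_dvd_not_less)
  obtain d where d: "quadrinomial (Suc m) k = int p * d" using dvd_quadrinomial[OF assms] by blast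
  let ?s = "quadrinomial m i + (if i < 1 then 0 else 2 * quadrinomial m (i - 1))
       + (if i < 2 then 0 else 3 * quadrinomial m (i - 2))"
  have "int p * (int k * d) = int p * (int n * ?s)"
    using quadrinomial_deriv[of i m] unfolding k[symmetric] d unfolding m[symmetric] by (simp add: ac_simps)
  hence "int k * d = int n * ?s"
    using assms by simp
  also have "[\<dots> = int n * (class_weight i 0 + (if i < 1 then 0 else 2 * class_weight (i - 1) 0)
     + (if i < 2 then 0 else 3 * class_weight (i - 2) 0))] (mod int p)"
    using assms k by (auto intro!: cong_scalar_left cong_add quadrinomial_cong_prime)
  finally have "[int k * d = int n * (1 - 4 * of_bool (k mod 4 = 0))] (mod int p)"
    unfolding class_weight_deriv k .
  hence "[d = int n * (1 - 4 * of_bool (k mod 4 = 0)) * recip p k] (mod int p)"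
    unfolding cong_mult_recip_iff[OF p \<open>\<not> p dvd k\<close>] .
  hence "[int p * d = int p * (int n * (1 - 4 * of_bool (k mod 4 = 0)) * recip p k)] (mod (int p * int p))"
    by (simp add: cong_iff_dvd_diff flip: right_diff_distrib)
  thus ?thesis unfolding d power2_eq_square by (simp only: ac_simps)
qed

lemma quadrinomial_cong_square:
  assumes "k < p"
  shows "[quadrinomial m k = class_weight k 0 + int n * int p *
           recip_sum p (\<lambda>j. class_weight k j * (1 - 4 * of_bool (j mod 4 = 0))) k] (mod (int p)\<^sup>2)"
proof -
  have "[(\<Sum>j=1..k. class_weight k j * quadrinomial (Suc m) j)
      = (\<Sum>j=1..k. class_weight k j * (int n * int p * ((1 - 4 * of_bool (j mod 4 = 0)) * recip p j)))] (mod (int p)\<^sup>2)"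
    by (intro cong_sum cong_scalar_left quadrinomial_Suc_cong_square) (use assms in auto)
  also have "(\<Sum>j=1..k. class_weight k j * (int n * int p * ((1 - 4 * of_bool (j mod 4 = 0)) * recip p j)))
     = int n * int p * recip_sum p (\<lambda>j. class_weight k j * (1 - 4 * of_bool (j mod 4 = 0))) k"
    unfolding recip_sum_def sum_distrib_left by (simp only: ac_simps)
  finally show ?thesis
    unfolding quadrinomial_eq_sum[of m] sum_atMost_split quadrinomial_0_right
    by (simp add: cong_add_lcancel)
qed

text \<open>The factor from log F gives class 0 the weight -3 and the other classes 1. The terms
  \<open>0 +\<close> and \<open>- - 3 *\<close> keep the shapes expected by
  \<open>p_cong_classes\<close> and by the linear combinations in \<open>theoremA\<close>.\<close>

lemma quadrinomial_class_sums:
  assumes "k < p"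
  shows "k mod 4 = 0 \<Longrightarrow> [quadrinomial m k = 1 + int n * int p * (- 3 * class_sum p 0 k - class_sum p 3 k)] (mod (int p)\<^sup>2)"
    and "k mod 4 = 1 \<Longrightarrow> [quadrinomial m k = - 1 + int n * int p * (class_sum p 1 k - - 3 * class_sum p 0 k)] (mod (int p)\<^sup>2)"
    and "k mod 4 = 2 \<Longrightarrow> [quadrinomial m k = 0 + int n * int p * (class_sum p 2 k - class_sum p 1 k)] (mod (int p)\<^sup>2)"
    and "k mod 4 = 3 \<Longrightarrow> [quadrinomial m k = 0 + int n * int p * (class_sum p 3 k - class_sum p 2 k)] (mod (int p)\<^sup>2)"
proof -
  note c = quadrinomial_cong_square[OF assms]
  have w0: "class_weight k 0 = of_bool (k mod 4 = 0) - of_bool (k mod 4 = 1)"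
    by (auto simp: class_weight_def)
  have r: "(\<lambda>j. class_weight k j * (1 - 4 * of_bool (j mod 4 = 0))) =
    (if k mod 4 = 0 then (\<lambda>j. - 3 * of_bool (j mod 4 = 0) - of_bool (j mod 4 = 3))
     else if k mod 4 = 1 then (\<lambda>j. of_bool (j mod 4 = 1) - - 3 * of_bool (j mod 4 = 0))
     else if k mod 4 = 2 then (\<lambda>j. of_bool (j mod 4 = 2) - of_bool (j mod 4 = 1))
     else (\<lambda>j. of_bool (j mod 4 = 3) - of_bool (j mod 4 = 2)))" (is "_ = ?rhs")
  proof
    fix j :: nat
    have "j mod 4 < 4" "k mod 4 < 4" by simp_all
    hence "j mod 4 = 0 \<or> j mod 4 = 1 \<or> j mod 4 = 2 \<or> j mod 4 = 3"
      "k mod 4 = 0 \<or> k mod 4 = 1 \<or> k mod 4 = 2 \<or> k mod 4 = 3" by linarith+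
    thus "class_weight k j * (1 - 4 * of_bool (j mod 4 = 0)) = ?rhs j"
      unfolding class_weight_def mod_Suc by (elim disjE) simp_all
  qed
  show "k mod 4 = 0 \<Longrightarrow> [quadrinomial m k = 1 + int n * int p * (- 3 * class_sum p 0 k - class_sum p 3 k)] (mod (int p)\<^sup>2)"
    and "k mod 4 = 1 \<Longrightarrow> [quadrinomial m k = - 1 + int n * int p * (class_sum p 1 k - - 3 * class_sum p 0 k)] (mod (int p)\<^sup>2)"
    and "k mod 4 = 2 \<Longrightarrow> [quadrinomial m k = 0 + int n * int p * (class_sum p 2 k - class_sum p 1 k)] (mod (int p)\<^sup>2)"
    and "k mod 4 = 3 \<Longrightarrow> [quadrinomial m k = 0 + int n * int p * (class_sum p 3 k - class_sum p 2 k)] (mod (int p)\<^sup>2)"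
    using c unfolding class_sum_def recip_sum_mult[symmetric] recip_sum_diff[symmetric] r w0 by simp_all
qed

end

section \<open>From integer congruences to \<open>p\<close>-integral rationals\<close>

lemma snd_quotient_of_quarter: "snd (quotient_of (of_int b / 4)) dvd 4"
proof -
  have "of_int b / 4 = Rat.Fract b 4" by (simp add: Fract_of_int_quotient)
  hence "snd (quotient_of (of_int b / 4)) = 4 div gcd b 4"
    by (simp add: quotient_of_Fract normalize_def Let_def)
  moreover have "4 = gcd b 4 * (4 div gcd b 4)" by simp
  ultimately show ?thesis by (metis dvd_triv_right)
qed

lemma quarter_p_integral:
  assumes "odd p"
  shows "of_int b / 4 \<in> p_integral p"
proof -
  have "coprime (2 ^ 2) (int p)" using assms by (subst coprime_power_left_iff) simp
  hence "coprime 4 (int p)" by simp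
  thus ?thesis
    unfolding p_integral_def using coprime_divisors[OF snd_quotient_of_quarter[of b] dvd_refl] by simp
qed

text \<open>The denominators that occur divide 4, a unit modulo the odd prime, so the congruence may
  be checked after multiplication by 4.\<close>

lemma p_cong_quarterI:
  assumes "odd p" "[4 * a = b] (mod (int p)\<^sup>2)" "y = of_int b / 4"
  shows "p_cong p 2 (of_int a) y"
proof -
  obtain z where z: "4 * a - b = (int p)\<^sup>2 * z"
    using assms(2) unfolding cong_iff_dvd_diff by blast
  have "of_int a - y = of_int (4 * a - b) / 4"
    by (simp add: assms(3) field_simps)
  also have "\<dots> = of_nat (p ^ 2) * (of_int z / 4)"
    unfolding z by simp
  finally have "of_int a - y = of_nat (p ^ 2) * (of_int z / 4)" .
  moreover have "(of_int a :: rat) = of_int (4 * a) / 4" by simp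
  ultimately show ?thesis
    unfolding p_cong_def using quarter_p_integral[OF assms(1)] assms(3) by metis
qed

lemma cong_square_scale:
  fixes S T :: int
  assumes "[X = w + int n * int p * S] (mod (int p)\<^sup>2)" "[4 * S = T] (mod int p)"
  shows "[4 * X = 4 * w + int n * int p * T] (mod (int p)\<^sup>2)"
proof -
  obtain k where k: "X - (w + int n * int p * S) = (int p)\<^sup>2 * k"
    using assms(1) unfolding cong_iff_dvd_diff by blast
  obtain l where l: "4 * S - T = int p * l"
    using assms(2) unfolding cong_iff_dvd_diff by blast
  have "4 * X - (4 * w + int n * int p * T)
      = 4 * (X - (w + int n * int p * S)) + int n * int p * (4 * S - T)"
    by (simp add: algebra_simps)
  also have "\<dots> = (int p)\<^sup>2 * (4 * k + int n * l)"
    unfolding k l by (simp add: power2_eq_square algebra_simps)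
  finally show ?thesis by (simp add: cong_iff_dvd_diff)
qed

text \<open>Solves the linear system of the four congruences for the even classes; the common factor
  4 avoids division. The first two give the full sums, the Pell congruence then \<open>B0\<close>,
  and the halving relation \<open>B2\<close>.\<close>

lemma class_sum_values:
  assumes "prime p" "p = Suc (2 * K)" "K > 0"
    and "2 ^ (p - 1) = 1 + int p * q"
    and "int (pell (nat (int p - Legendre 2 (int p)))) = int p * c"
  shows "[4 * class_sum p 0 (p - 1) = - 3 * q] (mod int p)"
    and "[4 * class_sum p 2 (p - 1) = - q] (mod int p)"
    and "[4 * class_sum p 0 K = - 4 * q - 2 * c] (mod int p)"
    and "[4 * class_sum p 2 K = - 2 * q + 2 * c] (mod int p)"
proof -
  define A0 A2 B0 B2 where "A0 = class_sum p 0 (p - 1)" and "A2 = class_sum p 2 (p - 1)"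
    and "B0 = class_sum p 0 K" and "B2 = class_sum p 2 K"
  have 1: "[A0 + A2 = - q] (mod int p)" unfolding A0_def A2_def
    by (rule class_sum_even_cong[OF assms(1-4)])
  have 2: "[2 * (A0 - A2) = - q] (mod int p)" unfolding A0_def A2_def
    by (rule class_sum_alternating_cong[OF assms(1-4)])
  have 3: "[2 * A0 = B0 + B2] (mod int p)" unfolding A0_def B0_def B2_def
    by (rule class_sum_half_cong[OF assms(1-4)])
  have 4: "[2 * c + q = - 4 * (B0 - A0)] (mod int p)" unfolding A0_def B0_def
    by (rule class_sum_pell_cong[OF assms])
  have A0: "[4 * A0 = - 3 * q] (mod int p)"
    using cong_add[OF cong_scalar_left[OF 1, of 2] 2] by (simp add: algebra_simps)
  have A2: "[4 * A2 = - q] (mod int p)"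
    using cong_diff[OF cong_scalar_left[OF 1, of 2] 2] by (simp add: algebra_simps)
  have B0: "[4 * B0 = - 4 * q - 2 * c] (mod int p)"
  proof -
    have "4 * B0 = 4 * A0 - - 4 * (B0 - A0)" "- 4 * q - 2 * c = - 3 * q - (2 * c + q)" by simp_all
    thus ?thesis using cong_diff[OF A0 cong_sym[OF 4]] by metis
  qed
  have "[4 * (B0 + B2) = 4 * (2 * A0)] (mod int p)"
    by (rule cong_scalar_left[OF cong_sym[OF 3]])
  also have "4 * (2 * A0) = 2 * (4 * A0)" by simp
  also have "[2 * (4 * A0) = 2 * (- 3 * q)] (mod int p)"
    by (rule cong_scalar_left[OF A0])
  finally have "[4 * (B0 + B2) - 4 * B0 = 2 * (- 3 * q) - (- 4 * q - 2 * c)] (mod int p)"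
    by (rule cong_diff[OF _ B0])
  moreover have "4 * (B0 + B2) - 4 * B0 = 4 * B2" "2 * (- 3 * q) - (- 4 * q - 2 * c) = - 2 * q + 2 * c"
    by simp_all
  ultimately have B2: "[4 * B2 = - 2 * q + 2 * c] (mod int p)" by metis
  show "[4 * class_sum p 0 (p - 1) = - 3 * q] (mod int p)"
    and "[4 * class_sum p 2 (p - 1) = - q] (mod int p)"
    and "[4 * class_sum p 0 K = - 4 * q - 2 * c] (mod int p)"
    and "[4 * class_sum p 2 K = - 2 * q + 2 * c] (mod int p)"
    using A0 A2 B0 B2 unfolding A0_def A2_def B0_def B2_def by simp_all
qed

lemma p_cong_classes:
  fixes p n :: nat and w S T :: int
  assumes "odd p" "[a = w + int n * int p * S] (mod (int p)\<^sup>2)" "[4 * S = T] (mod int p)"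
    and "y = of_int w + of_nat n * of_nat p * (of_int T / 4)"
  shows "p_cong p 2 (of_int a) y"
  by (rule p_cong_quarterI[OF assms(1) cong_square_scale[OF assms(2,3)]])
     (simp add: assms(4) field_simps)

lemma diff_mod_eq_iff:
  fixes i p r s k :: nat
  assumes "i \<le> p" "r < k" "s < k" "[r + s = p] (mod k)"
  shows "(p - i) mod k = r \<longleftrightarrow> i mod k = s"
proof -
  have s: "[(p - i) + i = r + s] (mod k)" using assms(1,4) by (simp add: cong_sym)
  have "[p - i = r] (mod k) \<longleftrightarrow> [i = s] (mod k)"
  proof
    assume "[p - i = r] (mod k)"
    hence "[r + i = r + s] (mod k)" by (metis cong_add_rcancel_nat cong_sym cong_trans s)
    thus "[i = s] (mod k)" by (simp only: cong_add_lcancel_nat)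
  next
    assume "[i = s] (mod k)"
    hence "[p - i + s = r + s] (mod k)" by (metis cong_add_lcancel_nat cong_sym cong_trans s)
    thus "[p - i = r] (mod k)" by (simp only: cong_add_rcancel_nat)
  qed
  thus ?thesis using assms(2,3) by (simp add: cong_def)
qed

section \<open>Evaluation in each residue class of \<open>p\<close> modulo 4 and modulo 8\<close>

theorem theoremA:
  fixes p n :: nat
  assumes "prime p" and "p \<ge> 5" and "n > 0"
  shows
    "([p = 1] (mod 4) \<longrightarrow>
        p_cong p 2 (of_int (quadrinomial (n * p - 1) (p - 1)))
          (1 + 2 * of_nat n * of_nat p * fermat_quotient p 2)) \<and>
     ([p = 3] (mod 4) \<longrightarrow>
        p_cong p 2 (of_int (quadrinomial (n * p - 1) (p - 1)))
          (- (1 / 2) * of_nat n * of_nat p * fermat_quotient p 2)) \<and>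
     ([p = 1] (mod 8) \<longrightarrow>
        p_cong p 2 (of_int (quadrinomial (n * p - 1) ((p - 1) div 2)))
          (1 + of_nat n * of_nat p * (13 / 4 * fermat_quotient p 2 + pell_quotient p))) \<and>
     ([p = 3] (mod 8) \<longrightarrow>
        p_cong p 2 (of_int (quadrinomial (n * p - 1) ((p - 1) div 2)))
          (- 1 - of_nat n * of_nat p * (13 / 4 * fermat_quotient p 2 + pell_quotient p))) \<and>
     ([p = 5] (mod 8) \<longrightarrow>
        p_cong p 2 (of_int (quadrinomial (n * p - 1) ((p - 1) div 2)))
          (- (of_nat n * of_nat p * (1 / 4 * fermat_quotient p 2 - pell_quotient p)))) \<and>
     ([p = 7] (mod 8) \<longrightarrow>
        p_cong p 2 (of_int (quadrinomial (n * p - 1) ((p - 1) div 2)))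
          (of_nat n * of_nat p * (1 / 4 * fermat_quotient p 2 - pell_quotient p)))"
proof -
  have "odd p" using assms(1,2) prime_odd_nat by auto
  then obtain K where pK: "p = Suc (2 * K)" by (auto elim: oddE)
  have K: "(p - 1) div 2 = K" "K > 0" "K < p" using pK assms(2) by auto
  obtain m where m: "n * p = Suc m" using assms by (metis gr0_implies_Suc nat_0_less_mult_iff prime_gt_0_nat)
  hence nm: "n * p - 1 = m" by simp
  have "\<not> p dvd 2"
    using assms(1) \<open>odd p\<close> by (metis primes_dvd_imp_eq two_is_prime_nat even_numeral)
  hence "[2 ^ (p - 1) = 1] (mod p)" by (rule fermat_theorem[OF assms(1)])
  hence "[int (2 ^ (p - 1)) = int 1] (mod int p)" by (simp only: cong_int_iff)
  hence "int p dvd 2 ^ (p - 1) - 1" by (simp add: cong_iff_dvd_diff)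
  then obtain q where "2 ^ (p - 1) - 1 = int p * q" by blast
  hence q: "2 ^ (p - 1) = 1 + int p * q" by simp
  obtain c where c: "int (pell (nat (int p - Legendre 2 (int p)))) = int p * c"
    using pell_prime_cong_square(1)[OF assms(1) \<open>odd p\<close>] by blast
  have p0: "(of_nat p :: rat) \<noteq> 0" using assms(2) by simp
  have "(2::rat) ^ (p - 1) = of_int (2 ^ (p - 1))" by simp
  hence fq: "fermat_quotient p 2 = of_int q"
    unfolding fermat_quotient_def q using p0 by simp
  have "(of_nat (pell (nat (int p - Legendre 2 (int p)))) :: rat)
      = of_int (int (pell (nat (int p - Legendre 2 (int p)))))" by simp
  hence pq: "pell_quotient p = of_int c"
    unfolding pell_quotient_def c using p0 by simp

  let ?A = "\<lambda>r. class_sum p r (p - 1)" and ?B = "\<lambda>r. class_sum p r K"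
  note val = class_sum_values[OF assms(1) pK K(2) q c]
  note reflect = class_sum_reflect[OF assms(1) pK K(2) q]
  note cs = quadrinomial_class_sums[OF assms(1) m]
  \<comment> \<open>Solves the first part of \<open>class_sum_reflect\<close> for the half-range sum
    over the reflected class.\<close>
  have upper: "[4 * ?B r' = b - a] (mod int p)"
    if "\<And>i. i \<le> p \<Longrightarrow> (p - i) mod 4 = r \<longleftrightarrow> i mod 4 = r'"
      "[4 * ?A r = a] (mod int p)" "[4 * ?B r = b] (mod int p)" for r r' a b
    using cong_diff[OF that(3) cong_trans[OF cong_sym[OF cong_scalar_left[OF reflect(1)[OF that(1)], of 4]] that(2)]]
    by (simp add: algebra_simps)
  have reflect_full: "[4 * ?A r' = - a] (mod int p)"
    if "\<And>i. i \<le> p \<Longrightarrow> (p - i) mod 4 = r' \<longleftrightarrow> i mod 4 = r" "[4 * ?A r = a] (mod int p)" for r r' a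
  proof -
    have "[4 * ?A r' = 4 * - ?A r] (mod int p)"
      by (intro cong_scalar_left reflect(2) that(1))
    moreover have "[4 * - ?A r = - a] (mod int p)"
      using that(2) by (simp add: cong_minus_minus_iff)
    ultimately show ?thesis by (rule cong_trans)
  qed
  \<comment> \<open>The reflection exchanges classes 0 and 1, and 2 and 3, if
    \<open>p mod 4 = 1\<close>; it exchanges 0 and 3, and 1 and 2, if
    \<open>p mod 4 = 3\<close>.\<close>
  have one: "p mod 4 = 1 \<Longrightarrow> i \<le> p \<Longrightarrow> (p - i) mod 4 = 0 \<longleftrightarrow> i mod 4 = 1"
    "p mod 4 = 1 \<Longrightarrow> i \<le> p \<Longrightarrow> (p - i) mod 4 = 2 \<longleftrightarrow> i mod 4 = 3"
    "p mod 4 = 1 \<Longrightarrow> i \<le> p \<Longrightarrow> (p - i) mod 4 = 3 \<longleftrightarrow> i mod 4 = 2" for i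
    by (rule diff_mod_eq_iff; simp add: cong_def)+
  have three: "p mod 4 = 3 \<Longrightarrow> i \<le> p \<Longrightarrow> (p - i) mod 4 = 0 \<longleftrightarrow> i mod 4 = 3"
    "p mod 4 = 3 \<Longrightarrow> i \<le> p \<Longrightarrow> (p - i) mod 4 = 2 \<longleftrightarrow> i mod 4 = 1"
    "p mod 4 = 3 \<Longrightarrow> i \<le> p \<Longrightarrow> (p - i) mod 4 = 1 \<longleftrightarrow> i mod 4 = 2" for i
    by (rule diff_mod_eq_iff; simp add: cong_def)+
  have at_one: "[4 * ?A 3 = - (- q)] (mod int p)"
    "[4 * ?B 1 = - 4 * q - 2 * c - - 3 * q] (mod int p)"
    "[4 * ?B 3 = - 2 * q + 2 * c - - q] (mod int p)" if "p mod 4 = 1"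
    by (rule reflect_full[OF _ val(2)] upper[OF _ val(1,3)] upper[OF _ val(2,4)]; rule one[OF that]; assumption)+
  have at_three: "[4 * ?A 1 = - (- q)] (mod int p)"
    "[4 * ?B 3 = - 4 * q - 2 * c - - 3 * q] (mod int p)"
    "[4 * ?B 1 = - 2 * q + 2 * c - - q] (mod int p)" if "p mod 4 = 3"
    by (rule reflect_full[OF _ val(2)] upper[OF _ val(1,3)] upper[OF _ val(2,4)]; rule three[OF that]; assumption)+
  have lin: "[4 * (x * u - v) = x * a - b] (mod int p)"
    if "[4 * u = a] (mod int p)" "[4 * v = b] (mod int p)" for x u v a b :: int
    using cong_diff[OF cong_scalar_left[OF that(1), of x] that(2)] by (simp add: algebra_simps)
  note lin1 = lin[where x = 1, simplified mult_1]
  have lin': "[4 * (u - x * v) = a - x * b] (mod int p)"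
    if "[4 * u = a] (mod int p)" "[4 * v = b] (mod int p)" for x u v a b :: int
    using cong_diff[OF that(1) cong_scalar_left[OF that(2), of x]] by (simp add: algebra_simps)

  have P: "(p - 1) mod 4 = r \<and> p - 1 < p" if "p mod 4 = Suc r" for r
  proof -
    have "p - 1 = r + 4 * (p div 4)" using mult_div_mod_eq[of 4 p] that by linarith
    moreover have "r < 4" using that mod_less_divisor[of 4 p] by simp
    hence "(r + 4 * (p div 4)) mod 4 = r" by simp
    ultimately show ?thesis using pK by (simp only: less_Suc_eq diff_Suc_1 simp_thms)
  qed
  have H: "p mod 4 = r mod 4" "K mod 4 = r div 2" if "[p = r] (mod 8)" "odd r" "r < 8" for r
  proof -
    have "p mod 8 = r" using that by (simp add: cong_def)
    thus "p mod 4 = r mod 4" using mod_mod_cancel[of 4 8 p] by simp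
    have "2 * (r div 2) + 1 = r" using that(2) by (rule odd_two_times_div_two_succ)
    hence "K = r div 2 + 4 * (p div 8)"
      using mult_div_mod_eq[of 8 p] \<open>p mod 8 = r\<close> pK by linarith
    moreover have "r div 2 < 4" using that(3) by simp
    ultimately show "K mod 4 = r div 2" by simp
  qed
  show ?thesis
    unfolding nm fq pq K(1)
  proof (intro conjI impI)
    assume "[p = 1] (mod 4)"
    hence p1: "p mod 4 = 1" by (simp add: cong_def)
    from P[of 0] have "(p - 1) mod 4 = 0" "p - 1 < p" by (simp_all add: p1)
    \<comment> \<open>Four times the bracket is \<open>- 3 * (- 3 * q) - q = 8 * q\<close>.\<close>
    from cs(1)[OF this(2,1)]
    show "p_cong p 2 (of_int (quadrinomial m (p - 1))) (1 + 2 * of_nat n * of_nat p * of_int q)"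
      by (rule p_cong_classes[OF \<open>odd p\<close> _ lin[OF val(1) at_one(1)[OF p1]]]) simp
  next
    assume "[p = 3] (mod 4)"
    hence p3: "p mod 4 = 3" by (simp add: cong_def)
    from P[of 2] have "(p - 1) mod 4 = 2" "p - 1 < p" by (simp_all add: p3)
    from cs(3)[OF this(2,1)]
    show "p_cong p 2 (of_int (quadrinomial m (p - 1))) (- (1 / 2) * of_nat n * of_nat p * of_int q)"
      by (rule p_cong_classes[OF \<open>odd p\<close> _ lin1[OF val(2) at_three(1)[OF p3]]]) simp
  next
    assume "[p = 1] (mod 8)"
    from H[OF this] have p1: "p mod 4 = 1" and "K mod 4 = 0" by simp_all
    \<comment> \<open>Four times the bracket is
      \<open>- 3 * (- 4 * q - 2 * c) - (- q + 2 * c) = 13 * q + 4 * c\<close>.\<close>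
    from cs(1)[OF K(3) this(2)]
    show "p_cong p 2 (of_int (quadrinomial m K)) (1 + of_nat n * of_nat p * (13 / 4 * of_int q + of_int c))"
      by (rule p_cong_classes[OF \<open>odd p\<close> _ lin[OF val(3) at_one(3)[OF p1]]])
         (simp add: algebra_simps add_divide_distrib diff_divide_distrib)
  next
    assume "[p = 3] (mod 8)"
    from H[OF this] have p3: "p mod 4 = 3" and "K mod 4 = 1" by simp_all
    from cs(2)[OF K(3) this(2)]
    show "p_cong p 2 (of_int (quadrinomial m K)) (- 1 - of_nat n * of_nat p * (13 / 4 * of_int q + of_int c))"
      by (rule p_cong_classes[OF \<open>odd p\<close> _ lin'[OF at_three(3)[OF p3] val(3)]])
         (simp add: algebra_simps add_divide_distrib diff_divide_distrib)
  next
    assume "[p = 5] (mod 8)"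
    from H[OF this] have p1: "p mod 4 = 1" and "K mod 4 = 2" by simp_all
    \<comment> \<open>Four times the bracket is
      \<open>(- 2 * q + 2 * c) - (- q - 2 * c) = - q + 4 * c\<close>.\<close>
    from cs(3)[OF K(3) this(2)]
    show "p_cong p 2 (of_int (quadrinomial m K)) (- (of_nat n * of_nat p * (1 / 4 * of_int q - of_int c)))"
      by (rule p_cong_classes[OF \<open>odd p\<close> _ lin1[OF val(4) at_one(2)[OF p1]]])
         (simp add: algebra_simps add_divide_distrib diff_divide_distrib)
  next
    assume "[p = 7] (mod 8)"
    from H[OF this] have p3: "p mod 4 = 3" and "K mod 4 = 3" by simp_all
    from cs(4)[OF K(3) this(2)]
    show "p_cong p 2 (of_int (quadrinomial m K)) (of_nat n * of_nat p * (1 / 4 * of_int q - of_int c))"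
      by (rule p_cong_classes[OF \<open>odd p\<close> _ lin1[OF at_three(2)[OF p3] val(4)]])
         (simp add: algebra_simps add_divide_distrib diff_divide_distrib)
  qed
qed

end
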